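(* Let $S$ be the set of major and minor triads. The $PLR$-group and the $T/I$-group, regarded as subgroups of the symmetric group $\mathrm{Sym}(S)$, are dual. That is, each acts simply transitively on $S$, and each is the centralizer of the other in $\mathrm{Sym}(S)$.
   Context: For $n \in \mathbb{Z}_{12}$ (integers modulo 12), define transposition $T_n$ and inversion $I_n$ as the functions $\mathbb{Z}_{12} \to \mathbb{Z}_{12}$ given by $T_n(x) = x + n$ and $I_n(x) = -x + n$ (mod 12). The $T/I$-group is the group (under composition) consisting of the 12 transpositions $T_n$ and the 12 inversions $I_n$. It acts componentwise on ordered triples: $g\langle y_1,y_2,y_3\rangle = \langle g(y_1),g(y_2),g(y_3)\rangle$. The set $S$ of major and minor triads (consonant triads) is the set of 24 ordered triples in $\mathbb{Z}_{12}^3$ consisting of the 12 major triads $T_n\langle 0,4,7\rangle = \langle n, n+4, n+7\rangle$ and the 12 minor triads $I_n\langle 0,4,7\rangle = \langle n, n-4, n-7\rangle$, for $n \in \mathbb{Z}_{12}$. The componentwise action of the $T/I$-group preserves $S$ and gives an injective homomorphism from the $T/I$-group into $\mathrm{Sym}(S)$, the group of all bijections $S \to S$ under composition; the $T/I$-group is identified with its image in $\mathrm{Sym}(S)$. The functions $P, L, R : S \to S$ are defined by $$P\langle y_1,y_2,y_3\rangle = I_{y_1+y_3}\langle y_1,y_2,y_3\rangle,$$ $$L\langle y_1,y_2,y_3\rangle = I_{y_2+y_3}\langle y_1,y_2,y_3\rangle,$$ $$R\langle y_1,y_2,y_3\rangle = I_{y_1+y_2}\langle y_1,y_2,y_3\rangle,$$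 where the inversions act componentwise; these are bijections of $S$. The $PLR$-group is the subgroup of $\mathrm{Sym}(S)$ generated by $P$, $L$ and $R$. A group $G$ acts simply transitively on $S$ if for any $Y, Z \in S$ there is a unique $g \in G$ with $gY = Z$. The centralizer of a subgroup $H$ of a group $G$ is $C_G(H) = \{g \in G \mid gh = hg \text{ for all } h \in H\}$. *)

theory Defs
  imports "HOL-Algebra.Bij" "HOL-Algebra.Generated_Groups" "HOL-Library.Numeral_Type"
begin

text \<open>The numeral type \<open>12\<close> is a twelve-element commutative ring with arithmetic modulo 12.\<close>

type_synonym pitch_class = 12
type_synonym triple = "pitch_class \<times> pitch_class \<times> pitch_class"

definition transposition :: "pitch_class \<Rightarrow> pitch_class \<Rightarrow> pitch_class" where
  "transposition n x = x + n"

definition inversion :: "pitch_class \<Rightarrow> pitch_class \<Rightarrow> pitch_class" where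
  "inversion n x = - x + n"

definition TI_functions :: "(pitch_class \<Rightarrow> pitch_class) set" where
  "TI_functions = range transposition \<union> range inversion"

definition componentwise :: "(pitch_class \<Rightarrow> pitch_class) \<Rightarrow> triple \<Rightarrow> triple" where
  "componentwise g = (\<lambda>(y1, y2, y3). (g y1, g y2, g y3))"

definition triads :: "triple set" where
  "triads = range (\<lambda>n. componentwise (transposition n) (0, 4, 7))
          \<union> range (\<lambda>n. componentwise (inversion n) (0, 4, 7))"

text \<open>
  The symmetric group on \<open>triads\<close> is \<open>BijGroup triads\<close>. Its elements are extensional
  functions (\<open>undefined\<close> outside \<open>triads\<close>), hence the restrictions below.
\<close>

definition TI_group :: "(triple \<Rightarrow> triple) set" where
  "TI_group = (\<lambda>g. restrict (componentwise g) triads) ` TI_functions"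

definition P_op :: "triple \<Rightarrow> triple" where
  "P_op = restrict
    (\<lambda>(y1, y2, y3). componentwise (inversion (y1 + y3)) (y1, y2, y3)) triads"

definition L_op :: "triple \<Rightarrow> triple" where
  "L_op = restrict
    (\<lambda>(y1, y2, y3). componentwise (inversion (y2 + y3)) (y1, y2, y3)) triads"

definition R_op :: "triple \<Rightarrow> triple" where
  "R_op = restrict
    (\<lambda>(y1, y2, y3). componentwise (inversion (y1 + y2)) (y1, y2, y3)) triads"

definition PLR_group :: "(triple \<Rightarrow> triple) set" where
  "PLR_group = generate (BijGroup triads) {P_op, L_op, R_op}"

definition simply_transitive :: "('a \<Rightarrow> 'a) set \<Rightarrow> 'a set \<Rightarrow> bool" where
  "simply_transitive H S \<longleftrightarrow> (\<forall>Y\<in>S. \<forall>Z\<in>S. \<exists>!g. g \<in> H \<and> g Y = Z)"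

definition centralizer :: "('a, 'b) monoid_scheme \<Rightarrow> 'a set \<Rightarrow> 'a set" where
  "centralizer G H = {g \<in> carrier G. \<forall>h\<in>H. g \<otimes>\<^bsub>G\<^esub> h = h \<otimes>\<^bsub>G\<^esub> g}"

definition dual_subgroups :: "'a set \<Rightarrow> ('a \<Rightarrow> 'a) set \<Rightarrow> ('a \<Rightarrow> 'a) set \<Rightarrow> bool" where
  "dual_subgroups S H K \<longleftrightarrow>
     subgroup H (BijGroup S) \<and> subgroup K (BijGroup S) \<and>
     simply_transitive H S \<and> simply_transitive K S \<and>
     H = centralizer (BijGroup S) K \<and> K = centralizer (BijGroup S) H"

end

theory Submission
  imports Defs
begin

text \<open>
  Two transitive subgroups \<open>H\<close> and \<open>K\<close> of a symmetric group that commute elementwise are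
  automatically dual. If \<open>h \<in> H\<close> fixes a point \<open>y\<close>, then it fixes \<open>k y\<close> for every \<open>k \<in> K\<close>, because
  \<open>h (k y) = k (h y) = k y\<close>; as \<open>K\<close> is transitive, \<open>h\<close> is the identity. The same idea shows that a
  bijection commuting with all of \<open>K\<close> is determined by its value at one point; since \<open>H\<close> is
  transitive, some \<open>h \<in> H\<close> has that value, so the centralizer of \<open>K\<close> is no larger than \<open>H\<close>
  (\<open>commuting_transitive_imp_dual\<close>). No orders have to be computed.

  It remains to see that the two groups commute and are transitive. Each of \<open>P\<close>, \<open>L\<close> and \<open>R\<close> applies
  to a triad the inversion that exchanges two of its components. An affine map \<open>x \<mapsto> \<plusminus>x + n\<close> carries
  the inversion exchanging \<open>a\<close> and \<open>b\<close> to the one exchanging their images, so it makes no difference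
  whether it is applied before or after the operation (\<open>PLR_in_centralizer\<close>).
  The \<open>T/I\<close>-group is transitive because the triads are by definition the orbit of \<open>(0, 4, 7)\<close>. For
  the \<open>PLR\<close>-group, \<open>L\<close> after \<open>R\<close> moves every major triad up by 5 semitones; 5 generates the integers
  modulo 12, so all major triads are reached, and \<open>P\<close> turns these into the minor ones.
\<close>

section \<open>Commuting transitive subgroups are dual\<close>

definition transitive_on :: "('a \<Rightarrow> 'a) set \<Rightarrow> 'a set \<Rightarrow> bool" where
  "transitive_on H S \<longleftrightarrow> (\<forall>Y\<in>S. \<forall>Z\<in>S. \<exists>g\<in>H. g Y = Z)"

lemma carrier_BijGroup: "carrier (BijGroup S) = Bij S"
  by (simp add: BijGroup_def)

lemma mult_BijGroup_apply:
  assumes "g \<in> carrier (BijGroup S)" "f \<in> carrier (BijGroup S)" "x \<in> S"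
  shows "(g \<otimes>\<^bsub>BijGroup S\<^esub> f) x = g (f x)"
  using assms by (simp add: BijGroup_def compose_def)

lemma one_BijGroup_apply: "x \<in> S \<Longrightarrow> \<one>\<^bsub>BijGroup S\<^esub> x = x"
  by (simp add: BijGroup_def)

lemma BijGroup_closed:
  assumes "g \<in> carrier (BijGroup S)" "x \<in> S"
  shows "g x \<in> S"
  using assms Bij_imp_funcset by (auto simp: carrier_BijGroup)

lemma BijGroup_eqI:
  assumes "f \<in> carrier (BijGroup S)" "g \<in> carrier (BijGroup S)" "\<And>x. x \<in> S \<Longrightarrow> f x = g x"
  shows "f = g"
  using assms by (auto simp: carrier_BijGroup intro: extensionalityI dest: Bij_imp_extensional)

lemma in_centralizer_iff:
  assumes "H \<subseteq> carrier (BijGroup S)"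
  shows "g \<in> centralizer (BijGroup S) H \<longleftrightarrow>
    g \<in> carrier (BijGroup S) \<and> (\<forall>h\<in>H. \<forall>x\<in>S. g (h x) = h (g x))"
proof -
  interpret group "BijGroup S" by (rule group_BijGroup)
  have "g \<otimes>\<^bsub>BijGroup S\<^esub> h = h \<otimes>\<^bsub>BijGroup S\<^esub> g \<longleftrightarrow> (\<forall>x\<in>S. g (h x) = h (g x))"
    if "g \<in> carrier (BijGroup S)" "h \<in> H" for h
  proof -
    have h: "h \<in> carrier (BijGroup S)"
      using that assms by blast
    show ?thesis
    proof
      assume "g \<otimes>\<^bsub>BijGroup S\<^esub> h = h \<otimes>\<^bsub>BijGroup S\<^esub> g"
      then show "\<forall>x\<in>S. g (h x) = h (g x)"
        using mult_BijGroup_apply[OF that(1) h] mult_BijGroup_apply[OF h that(1)] by metis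
    next
      assume "\<forall>x\<in>S. g (h x) = h (g x)"
      then show "g \<otimes>\<^bsub>BijGroup S\<^esub> h = h \<otimes>\<^bsub>BijGroup S\<^esub> g"
        using that(1) h by (intro BijGroup_eqI[where S = S]) (simp_all add: mult_BijGroup_apply)
    qed
  qed
  then show ?thesis
    unfolding centralizer_def by blast
qed

lemma (in group) centralizer_is_subgroup:
  assumes "H \<subseteq> carrier G"
  shows "subgroup (centralizer G H) G"
proof (rule subgroupI)
  show "centralizer G H \<subseteq> carrier G"
    by (auto simp: centralizer_def)
  have "\<one> \<in> centralizer G H"
    using assms by (auto simp: centralizer_def)
  then show "centralizer G H \<noteq> {}" by blast
next
  fix a assume a: "a \<in> centralizer G H"
  show "inv a \<in> centralizer G H"
    unfolding centralizer_def
  proof (intro CollectI conjI ballI)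
    show "inv a \<in> carrier G" using a by (simp add: centralizer_def)
    fix h assume h: "h \<in> H"
    then have [simp]: "a \<in> carrier G" "h \<in> carrier G" and ah: "a \<otimes> h = h \<otimes> a"
      using a assms by (auto simp: centralizer_def)
    have "inv a \<otimes> h = inv a \<otimes> (h \<otimes> a) \<otimes> inv a"
      by (simp add: m_assoc)
    also have "\<dots> = inv a \<otimes> (a \<otimes> h) \<otimes> inv a"
      by (simp add: ah)
    also have "\<dots> = h \<otimes> inv a"
      by (simp add: m_assoc[symmetric])
    finally show "inv a \<otimes> h = h \<otimes> inv a" .
  qed
next
  fix a b assume ab: "a \<in> centralizer G H" "b \<in> centralizer G H"
  show "a \<otimes> b \<in> centralizer G H"
    unfolding centralizer_def
  proof (intro CollectI conjI ballI)
    show "a \<otimes> b \<in> carrier G" using ab by (simp add: centralizer_def)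
    fix h assume h: "h \<in> H"
    then have [simp]: "a \<in> carrier G" "b \<in> carrier G" "h \<in> carrier G"
      and comm: "a \<otimes> h = h \<otimes> a" "b \<otimes> h = h \<otimes> b"
      using ab assms by (auto simp: centralizer_def)
    have "a \<otimes> b \<otimes> h = a \<otimes> h \<otimes> b"
      by (simp add: m_assoc comm(2))
    also have "\<dots> = h \<otimes> (a \<otimes> b)"
      by (simp add: m_assoc comm(1))
    finally show "a \<otimes> b \<otimes> h = h \<otimes> (a \<otimes> b)" .
  qed
qed

lemma transitive_on_if_single_orbit:
  assumes "subgroup H (BijGroup S)" "b \<in> S"
    and orbit: "\<And>Y. Y \<in> S \<Longrightarrow> \<exists>h\<in>H. h b = Y"
  shows "transitive_on H S"
  unfolding transitive_on_def
proof (intro ballI)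
  interpret group "BijGroup S" by (rule group_BijGroup)
  fix Y Z assume "Y \<in> S" "Z \<in> S"
  then obtain h k where h: "h \<in> H" "h b = Y" and k: "k \<in> H" "k b = Z"
    using orbit by meson
  let ?h' = "inv\<^bsub>BijGroup S\<^esub> h"
  have carr: "h \<in> carrier (BijGroup S)" "k \<in> carrier (BijGroup S)"
    using subgroup.mem_carrier[OF assms(1)] h k by auto
  have "?h' Y = (?h' \<otimes>\<^bsub>BijGroup S\<^esub> h) b"
    using mult_BijGroup_apply[OF inv_closed[OF carr(1)] carr(1) \<open>b \<in> S\<close>] h by simp
  also have "\<dots> = b"
    using carr \<open>b \<in> S\<close> by (simp add: one_BijGroup_apply)
  finally have "(k \<otimes>\<^bsub>BijGroup S\<^esub> ?h') Y = Z"
    using carr \<open>Y \<in> S\<close> k by (simp add: mult_BijGroup_apply)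
  moreover have "k \<otimes>\<^bsub>BijGroup S\<^esub> ?h' \<in> H"
    using assms(1) h k by (simp add: subgroup.m_closed subgroup.m_inv_closed)
  ultimately show "\<exists>g\<in>H. g Y = Z" by blast
qed

text \<open>
  The rigidity behind both halves of duality: the set of points where two maps commuting with \<open>H\<close>
  agree is a union of \<open>H\<close>-orbits, and a transitive \<open>H\<close> has only one.
\<close>

lemma centralizer_of_transitive_eqI:
  assumes H: "H \<subseteq> carrier (BijGroup S)" "transitive_on H S"
    and f: "f \<in> centralizer (BijGroup S) H" and g: "g \<in> centralizer (BijGroup S) H"
    and y: "y \<in> S" "f y = g y"
  shows "f = g"
proof (rule BijGroup_eqI)
  show "f \<in> carrier (BijGroup S)" "g \<in> carrier (BijGroup S)"
    using f g by (auto simp: centralizer_def)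
  fix x assume "x \<in> S"
  then obtain h where "h \<in> H" "h y = x"
    using H(2) y(1) unfolding transitive_on_def by blast
  then show "f x = g x"
    using f g y unfolding in_centralizer_iff[OF H(1)] by metis
qed

lemma simply_transitive_if_centralizes_transitive:
  assumes "H \<subseteq> carrier (BijGroup S)" "transitive_on H S"
    and "K \<subseteq> centralizer (BijGroup S) H" "transitive_on K S"
  shows "simply_transitive K S"
  unfolding simply_transitive_def
proof (intro ballI)
  fix Y Z assume YZ: "Y \<in> S" "Z \<in> S"
  then obtain k where k: "k \<in> K" "k Y = Z"
    using assms(4) unfolding transitive_on_def by blast
  show "\<exists>!g. g \<in> K \<and> g Y = Z"
  proof (rule ex1I[of _ k])
    fix g assume "g \<in> K \<and> g Y = Z"
    then show "g = k"
      using centralizer_of_transitive_eqI[OF assms(1,2)] assms(3) k YZ(1) by blast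
  qed (use k in blast)
qed

lemma centralizer_eq_if_transitive:
  assumes H: "H \<subseteq> carrier (BijGroup S)" "transitive_on H S"
    and K: "K \<subseteq> centralizer (BijGroup S) H" "transitive_on K S"
    and "S \<noteq> {}"
  shows "K = centralizer (BijGroup S) H"
proof (rule equalityI[OF K(1)], rule subsetI)
  fix c assume c: "c \<in> centralizer (BijGroup S) H"
  obtain y where y: "y \<in> S" using \<open>S \<noteq> {}\<close> by blast
  have "c y \<in> S"
    using c y by (auto simp: centralizer_def intro: BijGroup_closed)
  then obtain k where k: "k \<in> K" "k y = c y"
    using K(2) y unfolding transitive_on_def by blast
  then have "k = c"
    using centralizer_of_transitive_eqI[OF H] K(1) c y by blast
  then show "c \<in> K" using k by simp
qed

lemma commuting_transitive_imp_dual: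
  assumes H: "subgroup H (BijGroup S)" "transitive_on H S"
    and K: "subgroup K (BijGroup S)" "transitive_on K S"
    and HK: "H \<subseteq> centralizer (BijGroup S) K"
    and "S \<noteq> {}"
  shows "dual_subgroups S H K"
proof -
  have carr: "H \<subseteq> carrier (BijGroup S)" "K \<subseteq> carrier (BijGroup S)"
    using H(1) K(1) by (auto dest: subgroup.subset)
  have KH: "K \<subseteq> centralizer (BijGroup S) H"
    using HK carr unfolding centralizer_def by auto
  show ?thesis
    unfolding dual_subgroups_def
    using assms(1,3)
      simply_transitive_if_centralizes_transitive[OF carr(2) K(2) HK H(2)]
      simply_transitive_if_centralizes_transitive[OF carr(1) H(2) KH K(2)]
      centralizer_eq_if_transitive[OF carr(2) K(2) HK H(2) \<open>S \<noteq> {}\<close>]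
      centralizer_eq_if_transitive[OF carr(1) H(2) KH K(2) \<open>S \<noteq> {}\<close>]
    by blast
qed

section \<open>Transpositions and inversions acting on the triads\<close>

lemma TI_functions_cases:
  assumes "g \<in> TI_functions"
  obtains (transposition) n where "g = transposition n" | (inversion) n where "g = inversion n"
  using assms unfolding TI_functions_def by blast

lemma transposition_in_TI: "transposition n \<in> TI_functions"
  and inversion_in_TI: "inversion n \<in> TI_functions"
  by (auto simp: TI_functions_def)

lemma TI_functions_comp:
  assumes "g \<in> TI_functions" "h \<in> TI_functions"
  shows "g \<circ> h \<in> TI_functions"
proof -
  have "transposition m \<circ> transposition n = transposition (n + m)"
    "transposition m \<circ> inversion n = inversion (n + m)"
    "inversion m \<circ> transposition n = inversion (m - n)"
    "inversion m \<circ> inversion n = transposition (m - n)" for m n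
    by (auto simp: transposition_def inversion_def fun_eq_iff)
  then show ?thesis
    using assms by (auto elim!: TI_functions_cases simp: transposition_in_TI inversion_in_TI)
qed

lemma TI_functions_inverse:
  assumes "g \<in> TI_functions"
  obtains h where "h \<in> TI_functions" "\<And>x. h (g x) = x" "\<And>x. g (h x) = x"
  using assms
proof (cases rule: TI_functions_cases)
  case (transposition n)
  then show ?thesis
    using that[of "transposition (- n)"] transposition_in_TI by (simp add: transposition_def)
next
  case (inversion n)
  then show ?thesis
    using that[of "inversion n"] inversion_in_TI by (simp add: inversion_def)
qed

lemma componentwise_simp: "componentwise g (a, b, c) = (g a, g b, g c)"
  by (simp add: componentwise_def)

lemma componentwise_comp: "componentwise g (componentwise h Y) = componentwise (g \<circ> h) Y"
  by (cases Y) (simp add: componentwise_simp)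

lemma triads_eq_orbit: "triads = (\<lambda>g. componentwise g (0, 4, 7)) ` TI_functions"
  by (auto simp: triads_def TI_functions_def)

lemma componentwise_in_triads:
  assumes "g \<in> TI_functions" "Y \<in> triads"
  shows "componentwise g Y \<in> triads"
  using assms by (auto simp: triads_eq_orbit componentwise_comp TI_functions_comp)

lemma base_triad: "(0, 4, 7) \<in> triads"
  using transposition_in_TI[of 0]
  by (auto simp: triads_eq_orbit image_iff componentwise_simp transposition_def
      intro!: bexI[of _ "transposition 0"])

lemma triads_cases:
  assumes "Y \<in> triads"
  obtains (major) n where "Y = (n, n + 4, n + 7)" | (minor) n where "Y = (n, n - 4, n - 7)"
  using assms unfolding triads_def
  by (auto simp: componentwise_simp transposition_def inversion_def algebra_simps)

lemma major_in_triads: "(n, n + 4, n + 7) \<in> triads"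
  and minor_in_triads: "(n, n - 4, n - 7) \<in> triads"
  unfolding triads_def
  by (auto simp: componentwise_simp transposition_def inversion_def algebra_simps)

lemma restrict_in_BijGroup:
  assumes "\<And>x. x \<in> S \<Longrightarrow> f x \<in> S" "\<And>x. x \<in> S \<Longrightarrow> g x \<in> S"
    and "\<And>x. x \<in> S \<Longrightarrow> g (f x) = x" "\<And>x. x \<in> S \<Longrightarrow> f (g x) = x"
  shows "restrict f S \<in> carrier (BijGroup S)"
proof -
  have "bij_betw f S S"
    by (rule bij_betw_byWitness[of _ g]) (use assms in auto)
  then show ?thesis
    by (simp add: carrier_BijGroup Bij_def)
qed

lemma componentwise_in_BijGroup:
  assumes "g \<in> TI_functions"
  shows "restrict (componentwise g) triads \<in> carrier (BijGroup triads)"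
proof -
  obtain h where h: "h \<in> TI_functions" "\<And>x. h (g x) = x" "\<And>x. g (h x) = x"
    using TI_functions_inverse[OF assms] by blast
  show ?thesis
    by (rule restrict_in_BijGroup[of _ _ "componentwise h"])
      (use assms h in \<open>auto simp: componentwise_in_triads componentwise_simp\<close>)
qed

lemma subgroup_TI_group: "subgroup TI_group (BijGroup triads)"
proof -
  interpret group "BijGroup triads" by (rule group_BijGroup)
  let ?act = "\<lambda>g. restrict (componentwise g) triads"
  have mult: "?act g \<otimes>\<^bsub>BijGroup triads\<^esub> ?act h = ?act (g \<circ> h)"
    if "g \<in> TI_functions" "h \<in> TI_functions" for g h
    using that
    by (intro BijGroup_eqI[where S = triads] m_closed componentwise_in_BijGroup TI_functions_comp)
      (simp_all add: mult_BijGroup_apply componentwise_in_BijGroup componentwise_in_triads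
        componentwise_comp)
  show ?thesis
  proof (rule subgroupI)
    show "TI_group \<subseteq> carrier (BijGroup triads)"
      by (auto simp: TI_group_def componentwise_in_BijGroup)
    show "TI_group \<noteq> {}"
      using transposition_in_TI by (auto simp: TI_group_def)
  next
    fix a assume "a \<in> TI_group"
    then obtain g where g: "g \<in> TI_functions" "a = ?act g"
      by (auto simp: TI_group_def)
    obtain h where h: "h \<in> TI_functions" "\<And>x. h (g x) = x" "\<And>x. g (h x) = x"
      using TI_functions_inverse[OF g(1)] by blast
    have "?act h \<otimes>\<^bsub>BijGroup triads\<^esub> a = \<one>\<^bsub>BijGroup triads\<^esub>"
      using g h componentwise_in_BijGroup
      by (intro BijGroup_eqI[where S = triads])
        (auto simp: mult_BijGroup_apply one_BijGroup_apply componentwise_in_triads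
          componentwise_simp)
    then have "inv\<^bsub>BijGroup triads\<^esub> a = ?act h"
      using g h componentwise_in_BijGroup by (intro inv_equality) auto
    then show "inv\<^bsub>BijGroup triads\<^esub> a \<in> TI_group"
      using h by (simp add: TI_group_def)
  next
    fix a b assume "a \<in> TI_group" "b \<in> TI_group"
    then show "a \<otimes>\<^bsub>BijGroup triads\<^esub> b \<in> TI_group"
      using mult TI_functions_comp by (auto simp: TI_group_def)
  qed
qed

lemma transitive_TI_group: "transitive_on TI_group triads"
proof (rule transitive_on_if_single_orbit[OF subgroup_TI_group base_triad])
  fix Y assume "Y \<in> triads"
  then obtain g where "g \<in> TI_functions" "Y = componentwise g (0, 4, 7)"
    by (auto simp: triads_eq_orbit)
  then show "\<exists>h\<in>TI_group. h (0, 4, 7) = Y"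
    using base_triad by (auto simp: TI_group_def)
qed

section \<open>The operations P, L and R commute with the T/I-group\<close>

text \<open>
  By equivariance a single value decides whether a map preserves the triads, since these form the
  orbit of \<open>(0, 4, 7)\<close>.
\<close>

lemma equivariant_involution_in_centralizer:
  assumes equivariant: "\<And>g Y. g \<in> TI_functions \<Longrightarrow> f (componentwise g Y) = componentwise g (f Y)"
    and involution: "\<And>Y. f (f Y) = Y"
    and base: "f (0, 4, 7) \<in> triads"
  shows "restrict f triads \<in> centralizer (BijGroup triads) TI_group"
proof -
  have closed: "f Y \<in> triads" if Y: "Y \<in> triads" for Y
  proof -
    obtain g where "g \<in> TI_functions" "Y = componentwise g (0, 4, 7)"
      using Y by (auto simp: triads_eq_orbit)
    then show ?thesis
      using base by (simp add: equivariant componentwise_in_triads)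
  qed
  have "restrict f triads \<in> carrier (BijGroup triads)"
    by (rule restrict_in_BijGroup[of _ _ f]) (simp_all add: closed involution)
  moreover have "restrict f triads (h Y) = h (restrict f triads Y)"
    if "h \<in> TI_group" "Y \<in> triads" for h Y
    using that by (auto simp: TI_group_def closed componentwise_in_triads equivariant)
  ultimately show ?thesis
    by (simp add: in_centralizer_iff subgroup.subset[OF subgroup_TI_group])
qed

text \<open>
  Reflecting in the sum of two components swaps these two, so the sum, and with it the axis, is
  unchanged by the reflection: this is why each operation is an involution.
\<close>

lemma PLR_in_centralizer:
  "{P_op, L_op, R_op} \<subseteq> centralizer (BijGroup triads) TI_group"
proof -
  \<comment> \<open>The three images of the base triad are minor triads with first entries 7, 11 and 4.\<close>
  have base: "(7, 3, 0) \<in> triads" "(11, 7, 4) \<in> triads" "(4, 0, - 3) \<in> triads"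
    using minor_in_triads[of 7] minor_in_triads[of 11] minor_in_triads[of 4] by simp_all
  have "P_op \<in> centralizer (BijGroup triads) TI_group"
    unfolding P_op_def
    by (rule equivariant_involution_in_centralizer)
      (use base in \<open>auto elim!: TI_functions_cases
        simp: componentwise_simp transposition_def inversion_def algebra_simps\<close>)
  moreover have "L_op \<in> centralizer (BijGroup triads) TI_group"
    unfolding L_op_def
    by (rule equivariant_involution_in_centralizer)
      (use base in \<open>auto elim!: TI_functions_cases
        simp: componentwise_simp transposition_def inversion_def algebra_simps\<close>)
  moreover have "R_op \<in> centralizer (BijGroup triads) TI_group"
    unfolding R_op_def
    by (rule equivariant_involution_in_centralizer)
      (use base in \<open>auto elim!: TI_functions_cases
        simp: componentwise_simp transposition_def inversion_def algebra_simps\<close>)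
  ultimately show ?thesis by simp
qed

lemma PLR_in_BijGroup: "{P_op, L_op, R_op} \<subseteq> carrier (BijGroup triads)"
  using PLR_in_centralizer by (auto simp: centralizer_def)

lemma subgroup_PLR_group: "subgroup PLR_group (BijGroup triads)"
  unfolding PLR_group_def
  by (rule group.generate_is_subgroup[OF group_BijGroup PLR_in_BijGroup])

lemma PLR_group_centralizes_TI_group: "PLR_group \<subseteq> centralizer (BijGroup triads) TI_group"
  unfolding PLR_group_def
  by (intro group.generate_subgroup_incl[OF group_BijGroup PLR_in_centralizer]
      group.centralizer_is_subgroup[OF group_BijGroup] subgroup.subset[OF subgroup_TI_group])

section \<open>Transitivity of the PLR-group\<close>

lemma P_op_major: "P_op (n, n + 4, n + 7) = (n + 7, n + 7 - 4, n + 7 - 7)"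
  using major_in_triads[of n]
  by (simp add: P_op_def componentwise_simp inversion_def algebra_simps)

lemma R_op_major: "R_op (n, n + 4, n + 7) = (n + 4, n + 4 - 4, n + 4 - 7)"
  using major_in_triads[of n]
  by (simp add: R_op_def componentwise_simp inversion_def algebra_simps)

lemma L_op_minor: "L_op (n, n - 4, n - 7) = (n + 1, n + 1 + 4, n + 1 + 7)"
  using minor_in_triads[of n]
  by (simp add: L_op_def componentwise_simp inversion_def algebra_simps)

lemma pitch_class_of_nat:
  obtains k where "(n :: pitch_class) = of_nat k"
proof (cases n)
  case (of_int z)
  then show ?thesis
    using that[of "nat z"] by simp
qed

lemma transitive_PLR_group: "transitive_on PLR_group triads"
proof (rule transitive_on_if_single_orbit[OF subgroup_PLR_group base_triad])
  define orb where "orb = {f (0, 4, 7) | f. f \<in> PLR_group}"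
  have gens: "P_op \<in> PLR_group" "L_op \<in> PLR_group" "R_op \<in> PLR_group"
    by (auto simp: PLR_group_def intro: generate.incl)
  have orb_closed: "f Y \<in> orb" if f: "f \<in> PLR_group" and "Y \<in> orb" for f Y
  proof -
    obtain g where g: "g \<in> PLR_group" "Y = g (0, 4, 7)"
      using \<open>Y \<in> orb\<close> by (auto simp: orb_def)
    have "(f \<otimes>\<^bsub>BijGroup triads\<^esub> g) (0, 4, 7) = f Y"
      using f g subgroup.mem_carrier[OF subgroup_PLR_group] base_triad
      by (simp add: mult_BijGroup_apply)
    moreover have "f \<otimes>\<^bsub>BijGroup triads\<^esub> g \<in> PLR_group"
      by (rule subgroup.m_closed[OF subgroup_PLR_group f g(1)])
    ultimately show ?thesis
      unfolding orb_def by (metis (mono_tags, lifting) mem_Collect_eq)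
  qed
  have up5: "(n + 5, n + 5 + 4, n + 5 + 7) \<in> orb" if "(n, n + 4, n + 7) \<in> orb" for n
  proof -
    have "L_op (R_op (n, n + 4, n + 7)) \<in> orb"
      using that gens orb_closed by blast
    then show ?thesis
      unfolding R_op_major L_op_minor by (simp add: add.assoc)
  qed
  have up1: "(n + 1, n + 1 + 4, n + 1 + 7) \<in> orb" if "(n, n + 4, n + 7) \<in> orb" for n
  proof -
    \<comment> \<open>5 is its own inverse modulo 12, so five steps of 5 semitones make one semitone.\<close>
    have "n + 5 + 5 + 5 + 5 + 5 = n + 1" by simp
    then show ?thesis
      using up5[OF up5[OF up5[OF up5[OF up5[OF that]]]]] by (simp only:)
  qed
  have major_nat: "(of_nat k, of_nat k + 4, of_nat k + 7) \<in> orb" for k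
  proof (induction k)
    case 0
    have "\<one>\<^bsub>BijGroup triads\<^esub> (0, 4, 7) \<in> orb"
      using subgroup.one_closed[OF subgroup_PLR_group] unfolding orb_def by blast
    then show ?case
      using base_triad by (simp add: one_BijGroup_apply)
  next
    case (Suc k)
    then show ?case
      using up1[OF Suc] by (simp add: add.commute)
  qed
  have major: "(n, n + 4, n + 7) \<in> orb" for n
    by (rule pitch_class_of_nat[of n]) (use major_nat in simp)
  have minor: "(n, n - 4, n - 7) \<in> orb" for n
    using orb_closed[OF gens(1) major[of "n - 7"]] unfolding P_op_major by simp
  fix Y assume "Y \<in> triads"
  then have "Y \<in> orb"
    using major minor by (cases rule: triads_cases) auto
  then show "\<exists>h\<in>PLR_group. h (0, 4, 7) = Y"
    by (auto simp: orb_def)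
qed

section \<open>Duality of the PLR-group and the T/I-group\<close>

theorem theorem6p1:
  shows "dual_subgroups triads PLR_group TI_group"
  using base_triad
  by (intro commuting_transitive_imp_dual subgroup_PLR_group subgroup_TI_group
      transitive_PLR_group transitive_TI_group PLR_group_centralizes_TI_group) blast

end
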